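(* Let $\upsilon\colon\omega^2\to\omega^2$ be defined by $\upsilon\langle m,n\rangle=\langle m+1,n\rangle$. Then the operator $\ell_1(\upsilon)\colon\ell_1(\omega^2)\to\ell_1(\omega^2)$ is surjectively universal in the category of separable Banach spaces; that is, for every separable Banach space $E$ and every non-expansive linear operator $f\colon E\to E$ there is a non-expansive surjective linear operator $q\colon\ell_1(\omega^2)\to E$ such that $f\circ q=q\circ\ell_1(\upsilon)$.
   Context: Banach spaces are over a fixed scalar field, real or complex; an operator is non-expansive if its norm is at most $1$. $\omega$ is the set of natural numbers. For a nonempty set $S$, $\ell_1(S)$ is the Banach space of all summable scalar-valued functions on $S$ (those $v$ with $\sum_{s\in S}|v(s)|<+\infty$, which is the norm), and $\widehat{s}$ denotes the characteristic function of $\{s\}$. For a map $\varphi\colon S\to S$, $\ell_1(\varphi)\colon\ell_1(S)\to\ell_1(S)$ is the bounded linear operator determined by $\ell_1(\varphi)\widehat{s}=\widehat{\varphi(s)}$ for $s\in S$. *)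

theory Defs
  imports "HOL-Analysis.Analysis"
begin

(* The scalars range over the complete real normed fields, i.e. the class
   {real_normed_field, banach}.  It has the instances real and complex, and by the
   Gelfand-Mazur theorem every instance is isometrically isomorphic to one of these two. *)

(* The class banach only provides scalar multiplication by reals, so a Banach space over 'k
   is a banach type together with a multiplication by 'k that is compatible with the
   norm and restricts to the real multiplication of the type.  For 'k = real this forces
   scale = scaleR. *)
locale banach_space_over = vector_space scale
  for scale :: "'k::{real_normed_field,banach} \<Rightarrow> 'e::banach \<Rightarrow> 'e" +
  assumes scale_of_real: "scale (of_real r) x = r *\<^sub>R x"
    and norm_scale: "norm (scale c x) = norm c * norm x"

(* Library constant bounded_linear alone would only give linearity over the reals. *)
definition bounded_operator ::
  "('k::{real_normed_field,banach} \<Rightarrow> 'e::banach \<Rightarrow> 'e) \<Rightarrow> ('k \<Rightarrow> 'f::banach \<Rightarrow> 'f) \<Rightarrow> ('e \<Rightarrow> 'f) \<Rightarrow> bool"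
  where "bounded_operator s1 s2 T \<longleftrightarrow> Vector_Spaces.linear s1 s2 T \<and> bounded_linear T"

definition nonexpansive_operator ::
  "('k::{real_normed_field,banach} \<Rightarrow> 'e::banach \<Rightarrow> 'e) \<Rightarrow> ('k \<Rightarrow> 'f::banach \<Rightarrow> 'f) \<Rightarrow> ('e \<Rightarrow> 'f) \<Rightarrow> bool"
  where "nonexpansive_operator s1 s2 T \<longleftrightarrow> bounded_operator s1 s2 T \<and> onorm T \<le> 1"

(* The space of summable 'k-valued functions; the index set S is the type 's. *)
typedef (overloaded) ('s, 'k::real_normed_field) ell1 =
  "{v :: 's \<Rightarrow> 'k. (\<lambda>s. norm (v s)) summable_on UNIV}"
  morphisms ell1_apply Abs_ell1
  by (rule exI[of _ "\<lambda>_. 0"]) simp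

setup_lifting type_definition_ell1

lemma ell1_eqI: "(\<And>s. ell1_apply v s = ell1_apply w s) \<Longrightarrow> v = w"
  by (metis ell1_apply_inject ext)

lemma ell1_summable: "(\<lambda>s. norm (ell1_apply v s)) summable_on UNIV"
  using ell1_apply[of v] by simp

lemma ell1_summable_add:
  fixes v w :: "'s \<Rightarrow> 'k::real_normed_field"
  assumes "(\<lambda>s. norm (v s)) summable_on UNIV" "(\<lambda>s. norm (w s)) summable_on UNIV"
  shows "(\<lambda>s. norm (v s + w s)) summable_on UNIV"
proof (rule summable_on_comparison_test)
  show "(\<lambda>s. norm (v s) + norm (w s)) summable_on UNIV"
    using assms by (rule summable_on_add)
qed (auto intro: norm_triangle_ineq)

lemma ell1_summable_mult:
  fixes v :: "'s \<Rightarrow> 'k::real_normed_field"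
  assumes "(\<lambda>s. norm (v s)) summable_on UNIV"
  shows "(\<lambda>s. norm (c * v s)) summable_on UNIV"
  by (simp add: norm_mult assms summable_on_cmult_right)

instantiation ell1 :: (type, real_normed_field) real_vector
begin

lift_definition zero_ell1 :: "('a, 'b) ell1" is "\<lambda>_. 0" by simp

lift_definition uminus_ell1 :: "('a, 'b) ell1 \<Rightarrow> ('a, 'b) ell1" is "\<lambda>v s. - v s" by simp

lift_definition plus_ell1 :: "('a, 'b) ell1 \<Rightarrow> ('a, 'b) ell1 \<Rightarrow> ('a, 'b) ell1"
  is "\<lambda>v w s. v s + w s" by (rule ell1_summable_add)

lift_definition minus_ell1 :: "('a, 'b) ell1 \<Rightarrow> ('a, 'b) ell1 \<Rightarrow> ('a, 'b) ell1"
  is "\<lambda>v w s. v s - w s"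
  subgoal for v w using ell1_summable_add[of v "\<lambda>s. - w s"] by simp
  done

lift_definition scaleR_ell1 :: "real \<Rightarrow> ('a, 'b) ell1 \<Rightarrow> ('a, 'b) ell1"
  is "\<lambda>r v s. r *\<^sub>R v s"
  by (simp add: summable_on_cmult_right)

instance
  by standard (transfer; simp add: algebra_simps fun_eq_iff)+

end

lemmas ell1_rep_eq [simp] =
  zero_ell1.rep_eq uminus_ell1.rep_eq plus_ell1.rep_eq minus_ell1.rep_eq scaleR_ell1.rep_eq

instantiation ell1 :: (type, real_normed_field) real_normed_vector
begin

lift_definition norm_ell1 :: "('a, 'b) ell1 \<Rightarrow> real" is "\<lambda>v. \<Sum>\<^sub>\<infinity>s. norm (v s)" .

definition dist_ell1 :: "('a, 'b) ell1 \<Rightarrow> ('a, 'b) ell1 \<Rightarrow> real"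
  where "dist_ell1 v w = norm (v - w)"

definition sgn_ell1 :: "('a, 'b) ell1 \<Rightarrow> ('a, 'b) ell1"
  where "sgn_ell1 v = v /\<^sub>R norm v"

definition uniformity_ell1 :: "(('a, 'b) ell1 \<times> ('a, 'b) ell1) filter"
  where "uniformity_ell1 = (INF e\<in>{0 <..}. principal {(x, y). dist x y < e})"

definition open_ell1 :: "('a, 'b) ell1 set \<Rightarrow> bool"
  where "open_ell1 S = (\<forall>x\<in>S. \<forall>\<^sub>F (x', y) in uniformity. x' = x \<longrightarrow> y \<in> S)"

instance
proof
  fix r :: real and v w :: "('a, 'b) ell1"
  show "norm v = 0 \<longleftrightarrow> v = 0"
  proof
    assume "norm v = 0"
    hence "norm (ell1_apply v s) = 0" for s
      using finite_sum_le_infsum[OF ell1_summable[of v], of "{s}"]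
      by (simp add: norm_ell1.rep_eq)
    thus "v = 0" by (intro ell1_eqI) simp
  qed (simp add: norm_ell1.rep_eq)
  have "(\<Sum>\<^sub>\<infinity>s. norm (ell1_apply (v + w) s)) \<le>
        (\<Sum>\<^sub>\<infinity>s. norm (ell1_apply v s) + norm (ell1_apply w s))"
    by (rule infsum_mono)
      (auto intro: norm_triangle_ineq ell1_summable summable_on_add ell1_summable_add)
  thus "norm (v + w) \<le> norm v + norm w"
    by (simp add: norm_ell1.rep_eq infsum_add ell1_summable)
  show "norm (r *\<^sub>R v) = \<bar>r\<bar> * norm v"
    by (simp add: norm_ell1.rep_eq infsum_cmult_right')
qed (simp_all add: dist_ell1_def sgn_ell1_def uniformity_ell1_def open_ell1_def)

end

lemma ell1_sum_le_norm: "finite F \<Longrightarrow> (\<Sum>s\<in>F. norm (ell1_apply v s)) \<le> norm v"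
  unfolding norm_ell1.rep_eq by (rule finite_sum_le_infsum[OF ell1_summable]) auto

lemma ell1_norm_apply_le: "norm (ell1_apply v s) \<le> norm v"
  using ell1_sum_le_norm[of "{s}" v] by simp

lemma bounded_linear_ell1_apply: "bounded_linear (\<lambda>v. ell1_apply v s)"
  by (rule bounded_linear_intro[where K = 1]) (auto simp: ell1_norm_apply_le)

lemma ell1_bounded_sums:
  fixes v :: "'s \<Rightarrow> 'k::real_normed_field"
  assumes "\<And>F. finite F \<Longrightarrow> (\<Sum>s\<in>F. norm (v s)) \<le> e"
  shows "(\<lambda>s. norm (v s)) summable_on UNIV" "(\<Sum>\<^sub>\<infinity>s. norm (v s)) \<le> e"
proof -
  show sm: "(\<lambda>s. norm (v s)) summable_on UNIV"
    by (rule nonneg_bdd_above_summable_on) (auto intro!: bdd_aboveI[of _ e] assms)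
  show "(\<Sum>\<^sub>\<infinity>s. norm (v s)) \<le> e"
    by (rule infsum_le_finite_sums[OF sm]) (auto intro: assms)
qed

instance ell1 :: (type, "{real_normed_field,banach}") banach
proof
  fix X :: "nat \<Rightarrow> ('a, 'b) ell1"
  assume X: "Cauchy X"
  have "Cauchy (\<lambda>n. ell1_apply (X n) s)" for s
    using bounded_linear.Cauchy[OF bounded_linear_ell1_apply X] .
  hence "\<forall>s. \<exists>l. (\<lambda>n. ell1_apply (X n) s) \<longlonglongrightarrow> l"
    by (simp add: Cauchy_convergent_iff convergent_def)
  then obtain L where L: "\<And>s. (\<lambda>n. ell1_apply (X n) s) \<longlonglongrightarrow> L s" by metis
  have near: "\<exists>N. \<forall>m\<ge>N. \<forall>F. finite F \<longrightarrow> (\<Sum>s\<in>F. norm (ell1_apply (X m) s - L s)) \<le> e"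
    if e: "e > 0" for e
  proof -
    obtain N where N: "\<And>m n. m \<ge> N \<Longrightarrow> n \<ge> N \<Longrightarrow> norm (X m - X n) < e"
      using CauchyD[OF X e] by blast
    have "(\<Sum>s\<in>F. norm (ell1_apply (X m) s - L s)) \<le> e" if m: "m \<ge> N" and F: "finite F" for m F
    proof (rule LIMSEQ_le_const2)
      show "(\<lambda>n. \<Sum>s\<in>F. norm (ell1_apply (X m) s - ell1_apply (X n) s))
              \<longlonglongrightarrow> (\<Sum>s\<in>F. norm (ell1_apply (X m) s - L s))"
        by (intro tendsto_intros L)
      have "(\<Sum>s\<in>F. norm (ell1_apply (X m) s - ell1_apply (X n) s)) \<le> e" if "n \<ge> N" for n
        using ell1_sum_le_norm[OF F, of "X m - X n"] N[OF m that] by simp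
      thus "\<exists>N. \<forall>n\<ge>N. (\<Sum>s\<in>F. norm (ell1_apply (X m) s - ell1_apply (X n) s)) \<le> e" by blast
    qed
    thus ?thesis by blast
  qed
  obtain N where N: "\<And>F. finite F \<Longrightarrow> (\<Sum>s\<in>F. norm (ell1_apply (X N) s - L s)) \<le> 1"
    using near[of 1] by force
  have "(\<lambda>s. norm (ell1_apply (X N) s - L s)) summable_on UNIV"
    using N by (rule ell1_bounded_sums)
  hence "(\<lambda>s. norm (L s - ell1_apply (X N) s)) summable_on UNIV"
    by (simp add: norm_minus_commute)
  from ell1_summable_add[OF this ell1_summable[of "X N"]]
  have Lsum: "(\<lambda>s. norm (L s)) summable_on UNIV" by simp
  define l where "l = Abs_ell1 L"
  have l: "ell1_apply l = L" using Lsum by (simp add: l_def Abs_ell1_inverse)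
  have "X \<longlonglongrightarrow> l"
  proof (rule LIMSEQ_I)
    fix e :: real assume "e > 0"
    hence "e / 2 > 0" by simp
    from near[OF this] obtain M where
      M: "\<And>m F. m \<ge> M \<Longrightarrow> finite F \<Longrightarrow> (\<Sum>s\<in>F. norm (ell1_apply (X m) s - L s)) \<le> e / 2" by blast
    have "norm (X m - l) < e" if "m \<ge> M" for m
    proof -
      have "norm (X m - l) \<le> e / 2"
        using ell1_bounded_sums(2)[OF M[OF that]] by (simp add: norm_ell1.rep_eq l)
      thus ?thesis using \<open>e > 0\<close> by simp
    qed
    thus "\<exists>M. \<forall>m\<ge>M. norm (X m - l) < e" by blast
  qed
  thus "convergent X" by (auto simp: convergent_def)
qed

lift_definition ell1_scale :: "'k::real_normed_field \<Rightarrow> ('s, 'k) ell1 \<Rightarrow> ('s, 'k) ell1"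
  is "\<lambda>c v s. c * v s" by (rule ell1_summable_mult)

lift_definition ell1_unit :: "'s \<Rightarrow> ('s, 'k::real_normed_field) ell1"
  is "\<lambda>s t. if t = s then 1 else 0"
  subgoal for s
    by (rule finite_nonzero_values_imp_summable_on) (auto intro: finite_subset[of _ "{s}"])
  done

lemmas ell1_rep_eq' [simp] = ell1_scale.rep_eq ell1_unit.rep_eq

lemma banach_space_over_ell1_scale:
  "banach_space_over (ell1_scale :: 'k::{real_normed_field,banach} \<Rightarrow> ('s, 'k) ell1 \<Rightarrow> ('s, 'k) ell1)"
  by unfold_locales
    (auto intro!: ell1_eqI simp: algebra_simps scaleR_conv_of_real norm_ell1.rep_eq norm_mult
      infsum_cmult_right')

lemma norm_ell1_unit [simp]: "norm (ell1_unit s :: ('s, 'k::real_normed_field) ell1) = 1"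
proof -
  have "((\<lambda>t. norm (ell1_apply (ell1_unit s :: ('s, 'k) ell1) t)) has_sum 1) UNIV"
    by (rule has_sum_finite_neutralI[of "{s}"]) auto
  thus ?thesis by (simp add: norm_ell1.rep_eq infsumI)
qed

lemma ell1_has_sum_units:
  fixes v :: "('s, 'k::{real_normed_field,banach}) ell1"
  shows "((\<lambda>s. ell1_scale (ell1_apply v s) (ell1_unit s)) has_sum v) UNIV"
proof -
  let ?g = "\<lambda>s. ell1_scale (ell1_apply v s) (ell1_unit s)"
  have "(\<lambda>s. norm (?g s)) summable_on UNIV"
    using ell1_summable[of v]
    by (simp add: banach_space_over.norm_scale[OF banach_space_over_ell1_scale])
  from abs_summable_summable[OF this] obtain w where w: "(?g has_sum w) UNIV"
    unfolding summable_on_def by blast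
  have "ell1_apply w t = ell1_apply v t" for t
  proof (rule has_sum_unique)
    show "((\<lambda>s. ell1_apply (?g s) t) has_sum ell1_apply w t) UNIV"
      by (rule has_sum_bounded_linear[OF bounded_linear_ell1_apply w])
    show "((\<lambda>s. ell1_apply (?g s) t) has_sum ell1_apply v t) UNIV"
      by (rule has_sum_finite_neutralI[of "{t}"]) auto
  qed
  hence "w = v" by (rule ell1_eqI)
  with w show ?thesis by simp
qed

lemma bounded_operator_has_sum:
  assumes "bounded_operator ell1_scale s2 T"
  shows "((\<lambda>s. s2 (ell1_apply v s) (T (ell1_unit s))) has_sum T v) UNIV"
proof -
  interpret Vector_Spaces.linear ell1_scale s2 T
    using assms by (simp add: bounded_operator_def)
  show ?thesis
    using has_sum_bounded_linear[OF _ ell1_has_sum_units[of v], of T] assms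
    by (simp add: bounded_operator_def scale)
qed

lemma ell1_operator_exists:
  fixes s2 :: "'k::{real_normed_field,banach} \<Rightarrow> 'e::banach \<Rightarrow> 'e"
    and x :: "'s \<Rightarrow> 'e"
  assumes s2: "banach_space_over s2" and x: "\<And>s. norm (x s) \<le> 1"
  shows "\<exists>T. nonexpansive_operator ell1_scale s2 T \<and> (\<forall>s. T (ell1_unit s) = x s)"
proof -
  interpret E: banach_space_over s2 by fact
  interpret L: banach_space_over "ell1_scale :: 'k \<Rightarrow> ('s, 'k) ell1 \<Rightarrow> _"
    by (rule banach_space_over_ell1_scale)
  define T where "T v = (\<Sum>\<^sub>\<infinity>s. s2 (ell1_apply v s) (x s))" for v
  have le: "norm (s2 (ell1_apply v s) (x s)) \<le> norm (ell1_apply v s)" for v s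
    using mult_left_mono[OF x norm_ge_zero] by (simp add: E.norm_scale)
  have abs: "(\<lambda>s. norm (s2 (ell1_apply v s) (x s))) summable_on UNIV" for v
    by (rule summable_on_comparison_test[OF ell1_summable[of v]]) (auto intro: le)
  note sm = abs_summable_summable[OF abs]
  have add: "T (v + w) = T v + T w" for v w
    unfolding T_def by (simp add: E.scale_left_distrib infsum_add sm)
  have bl: "bounded_linear (s2 c)" for c
    by (rule bounded_linear_intro[where K = "norm c"])
      (simp_all add: E.scale_right_distrib E.norm_scale mult.commute E.scale_left_commute
        flip: E.scale_of_real)
  have scale: "T (ell1_scale c v) = s2 c (T v)" for c v
    unfolding T_def
    using infsumI[OF has_sum_bounded_linear[OF bl has_sum_infsum[OF sm]], of c v] by simp
  have scaleR: "T (r *\<^sub>R v) = r *\<^sub>R T v" for r v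
    using scale[of "of_real r" v] by (simp add: E.scale_of_real L.scale_of_real)
  have norm: "norm (T v) \<le> norm v" for v
  proof -
    have "norm (T v) \<le> (\<Sum>\<^sub>\<infinity>s. norm (s2 (ell1_apply v s) (x s)))"
      unfolding T_def by (rule norm_infsum_bound[OF abs])
    also have "\<dots> \<le> norm v"
      unfolding norm_ell1.rep_eq by (rule infsum_mono[OF abs ell1_summable le])
    finally show ?thesis .
  qed
  have "bounded_linear T"
    by (rule bounded_linear_intro[where K = 1]) (auto simp: add scaleR norm)
  moreover have "onorm T \<le> 1" by (rule onorm_bound) (auto simp: norm)
  moreover have "Vector_Spaces.linear ell1_scale s2 T"
    by unfold_locales (auto simp: add scale)
  moreover have "T (ell1_unit s) = x s" for s
    unfolding T_def
    by (rule infsumI, rule has_sum_finite_neutralI[of "{s}"]) auto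
  ultimately show ?thesis
    by (auto simp: nonexpansive_operator_def bounded_operator_def)
qed

definition ell1_map :: "('s \<Rightarrow> 't) \<Rightarrow> ('s, 'k::{real_normed_field,banach}) ell1 \<Rightarrow> ('t, 'k) ell1"
  where "ell1_map \<phi> = (THE T. bounded_operator ell1_scale ell1_scale T \<and>
                               (\<forall>s. T (ell1_unit s) = ell1_unit (\<phi> s)))"

lemma ell1_operator_unique:
  assumes "bounded_operator ell1_scale s2 T" "bounded_operator ell1_scale s2 U"
    and "\<And>s. T (ell1_unit s) = U (ell1_unit s)"
  shows "T = U"
proof
  fix v
  show "T v = U v"
    using bounded_operator_has_sum[OF assms(1), of v] bounded_operator_has_sum[OF assms(2), of v]
    by (simp add: assms(3) has_sum_unique)
qed

lemma ell1_map:
  fixes \<phi> :: "'s \<Rightarrow> 't"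
  defines "T \<equiv> (ell1_map \<phi> :: ('s, 'k::{real_normed_field,banach}) ell1 \<Rightarrow> _)"
  shows "nonexpansive_operator ell1_scale ell1_scale T" "T (ell1_unit s) = ell1_unit (\<phi> s)"
proof -
  obtain U :: "('s, 'k) ell1 \<Rightarrow> ('t, 'k) ell1" where
    U: "nonexpansive_operator ell1_scale ell1_scale U" "\<And>s. U (ell1_unit s) = ell1_unit (\<phi> s)"
    using ell1_operator_exists[OF banach_space_over_ell1_scale, of "\<lambda>s. ell1_unit (\<phi> s)"] by auto
  have "T = U"
    unfolding T_def ell1_map_def
    using U by (intro the_equality) (auto simp: nonexpansive_operator_def intro: ell1_operator_unique)
  with U show "nonexpansive_operator ell1_scale ell1_scale T" "T (ell1_unit s) = ell1_unit (\<phi> s)"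
    by auto
qed

definition upsilon :: "nat \<times> nat \<Rightarrow> nat \<times> nat"
  where "upsilon = (\<lambda>(m, n). (m + 1, n))"

end

theory Submission
  imports Defs
begin

text \<open>
  An operator out of \<open>\<ell>\<^sub>1(S)\<close> is the same as a bounded family of vectors, namely its values on the
  unit vectors, so \<open>q\<close> is described by the vectors \<open>q\<langle>m,n\<rangle>\<close>. On unit vectors the equation
  \<open>f \<circ> q = q \<circ> \<ell>\<^sub>1(\<upsilon>)\<close> says that \<open>q\<langle>m+1,n\<rangle> = f (q\<langle>m,n\<rangle>)\<close>: each column \<open>n\<close> is the free
  \<open>f\<close>-orbit of its starting vector. Hence starting vectors \<open>x\<^sub>n\<close> may be chosen at will in the unit
  ball, with \<open>q\<langle>m,n\<rangle> = f\<^sup>m x\<^sub>n\<close>, and \<open>q\<close> is non-expansive because \<open>f\<close> is.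

  Separability lets the \<open>x\<^sub>n\<close> be dense in the unit ball. Then every vector \<open>y\<close> is approximated,
  up to an error of half its norm, by the image of a multiple of a single unit vector, and the
  successive-approximation half of the open mapping theorem (\<open>surj_if_approximable\<close>) shows that
  \<open>q\<close> is onto.
\<close>

text \<open>
  Approximating \<open>y\<close>, then the remaining error, and so on, gives errors that decay geometrically.
  The corrections are at most \<open>K\<close> times the errors, so they add up to an element of the complete space
  \<open>'a\<close>, and its image is \<open>y\<close> by telescoping.
\<close>
lemma surj_if_approximable:
  fixes T :: "'a::banach \<Rightarrow> 'b::real_normed_vector"
  assumes "bounded_linear T" and c: "c < 1"
    and approx: "\<And>y. \<exists>v. norm v \<le> K * norm y \<and> norm (y - T v) \<le> c * norm y"
  shows "surj T"
proof -
  interpret T: bounded_linear T by fact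
  obtain g where g: "\<And>y. norm (g y) \<le> K * norm y" "\<And>y. norm (y - T (g y)) \<le> c * norm y"
    using approx by metis
  \<comment> \<open>Larger constants remain valid; these two are nonnegative.\<close>
  define c' K' where "c' = max c 0" and "K' = max K 0"
  have c': "0 \<le> c'" "c' < 1" and K': "0 \<le> K'"
    using c by (auto simp: c'_def K'_def)
  have g': "norm (g y) \<le> K' * norm y" "norm (y - T (g y)) \<le> c' * norm y" for y
    using g[of y] mult_right_mono[of K K' "norm y"] mult_right_mono[of c c' "norm y"]
    by (auto simp: c'_def K'_def)
  have "\<exists>v. y = T v" for y
  proof -
    define r where "r n = ((\<lambda>y. y - T (g y)) ^^ n) y" for n
    have r_Suc: "r (Suc n) = r n - T (g (r n))" for n
      by (simp add: r_def)
    have r_le: "norm (r n) \<le> c' ^ n * norm y" for n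
    proof (induction n)
      case (Suc n)
      have "norm (r (Suc n)) \<le> c' * norm (r n)"
        unfolding r_Suc by (rule g')
      also have "\<dots> \<le> c' * (c' ^ n * norm y)"
        using Suc c' by (intro mult_left_mono)
      finally show ?case by simp
    qed (simp add: r_def)
    have geom: "(\<lambda>n. c' ^ n * norm y) \<longlonglongrightarrow> 0"
      using c' by (intro tendsto_mult_left_zero LIMSEQ_realpow_zero)
    have "r \<longlonglongrightarrow> 0"
      by (rule Lim_null_comparison[OF _ geom]) (simp add: r_le)
    hence "(\<lambda>n. r n - r (Suc n)) sums (r 0 - 0)"
      by (rule telescope_sums')
    hence tel: "(\<lambda>n. T (g (r n))) sums y"
      by (simp add: r_Suc) (simp add: r_def)
    have "summable (\<lambda>n. g (r n))"
    proof (rule summable_comparison_test')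
      show "summable (\<lambda>n. K' * (c' ^ n * norm y))"
        using c' by (intro summable_mult summable_mult2 summable_geometric) simp
      show "norm (g (r n)) \<le> K' * (c' ^ n * norm y)" for n
        using g'(1)[of "r n"] mult_left_mono[OF r_le[of n] K'] by simp
    qed
    hence "(\<lambda>n. T (g (r n))) sums T (\<Sum>n. g (r n))"
      by (intro T.sums summable_sums)
    with tel show ?thesis
      using sums_unique2 by blast
  qed
  thus ?thesis by (simp add: surj_def)
qed

text \<open>
  Members of a countable dense set that fall outside the ball are replaced by \<open>0\<close>. Density is
  claimed for the open ball, which is open and so still met densely by the members kept.
\<close>
lemma separable_unit_ball_sequence:
  assumes "separable_space (euclidean :: 'e::real_normed_vector topology)"
  obtains x :: "nat \<Rightarrow> 'e::real_normed_vector"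
  where "\<And>n. norm (x n) \<le> 1" "\<And>z e. norm z < 1 \<Longrightarrow> e > 0 \<Longrightarrow> \<exists>n. dist (x n) z < e"
proof -
  obtain D :: "'e set" where D: "countable D" "closure D = UNIV"
    using assms by (auto simp: separable_space_def)
  hence ne: "D \<noteq> {}" by auto
  define x where "x n = (if norm (from_nat_into D n) \<le> 1 then from_nat_into D n else 0)" for n
  have "\<exists>n. dist (x n) z < e" if z: "norm z < 1" and e: "e > 0" for z e
  proof -
    have "min e (1 - norm z) > 0" using z e by simp
    moreover have "z \<in> closure D" using D by simp
    ultimately obtain d where d: "d \<in> D" "dist d z < min e (1 - norm z)"
      by (meson closure_approachable)
    obtain n where n: "from_nat_into D n = d"
      using from_nat_into_surj[OF D(1) d(1)] by blast
    have "norm d \<le> 1"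
      using d(2) norm_triangle_ineq2[of d z] by (simp add: dist_norm)
    with n d(2) show ?thesis by (intro exI[of _ n]) (simp add: x_def)
  qed
  moreover have "norm (x n) \<le> 1" for n by (simp add: x_def)
  ultimately show thesis using that by blast
qed

lemma nonexpansive_operator_norm_le:
  assumes "nonexpansive_operator s1 s2 T"
  shows "norm (T v) \<le> norm v"
proof -
  have "norm (T v) \<le> onorm T * norm v"
    using assms by (intro onorm) (simp add: nonexpansive_operator_def bounded_operator_def)
  also have "\<dots> \<le> 1 * norm v"
    using assms by (intro mult_right_mono) (simp_all add: nonexpansive_operator_def)
  finally show ?thesis by simp
qed

lemma bounded_operator_comp:
  assumes "bounded_operator s1 s2 T" "bounded_operator s2 s3 U"
  shows "bounded_operator s1 s3 (U \<circ> T)"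
proof -
  have "Vector_Spaces.linear s1 s3 (U \<circ> T)"
    using assms Vector_Spaces.linear_compose[of s1 s2 T s3 U] by (simp add: bounded_operator_def)
  moreover have "bounded_linear (U \<circ> T)"
    using assms bounded_linear_compose[of U T] by (simp add: bounded_operator_def comp_def)
  ultimately show ?thesis by (simp add: bounded_operator_def)
qed

theorem corollary1p4:
  fixes scale :: "'k::{real_normed_field,banach} \<Rightarrow> 'e::banach \<Rightarrow> 'e"
    and f :: "'e \<Rightarrow> 'e"
  assumes "banach_space_over scale"
    and "separable_space (euclidean :: 'e topology)"
    and "nonexpansive_operator scale scale f"
  shows "\<exists>q :: (nat \<times> nat, 'k) ell1 \<Rightarrow> 'e.
           nonexpansive_operator ell1_scale scale q \<and> surj q \<and>
           f \<circ> q = q \<circ> ell1_map upsilon"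
proof -
  obtain x :: "nat \<Rightarrow> 'e" where x: "\<And>n. norm (x n) \<le> 1"
    and dense: "\<And>z e. norm z < 1 \<Longrightarrow> e > 0 \<Longrightarrow> \<exists>n. dist (x n) z < e"
    using separable_unit_ball_sequence[OF assms(2)] by blast
  have "norm ((f ^^ m) (x n)) \<le> 1" for m n
  proof (induction m)
    case (Suc m)
    thus ?case using nonexpansive_operator_norm_le[OF assms(3), of "(f ^^ m) (x n)"] by simp
  qed (simp add: x)
  hence "norm ((\<lambda>(m, n). (f ^^ m) (x n)) s) \<le> 1" for s
    by (cases s) simp
  from ell1_operator_exists[OF assms(1), of "\<lambda>(m, n). (f ^^ m) (x n)", OF this]
  obtain q :: "(nat \<times> nat, 'k) ell1 \<Rightarrow> 'e" where q: "nonexpansive_operator ell1_scale scale q"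
    and q_unit: "\<And>m n. q (ell1_unit (m, n)) = (f ^^ m) (x n)"
    by auto
  have bounded: "bounded_operator ell1_scale scale q" "bounded_operator scale scale f"
    "bounded_operator ell1_scale ell1_scale
       (ell1_map upsilon :: (nat \<times> nat, 'k) ell1 \<Rightarrow> (nat \<times> nat, 'k) ell1)"
    using q assms(3) ell1_map(1)[where 'k = 'k and \<phi> = upsilon]
    by (simp_all add: nonexpansive_operator_def)
  have "f \<circ> q = q \<circ> ell1_map upsilon"
  proof (rule ell1_operator_unique)
    show "bounded_operator ell1_scale scale (f \<circ> q)"
      "bounded_operator ell1_scale scale (q \<circ> ell1_map upsilon)"
      using bounded by (auto intro: bounded_operator_comp)
    show "(f \<circ> q) (ell1_unit s) = (q \<circ> ell1_map upsilon) (ell1_unit s)" for s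
      by (cases s) (simp add: ell1_map(2) upsilon_def q_unit)
  qed
  moreover have "surj q"
  proof (rule surj_if_approximable)
    show lin: "bounded_linear q" using bounded(1) by (simp add: bounded_operator_def)
    show "(1 / 2 :: real) < 1" by simp
    show "\<exists>v. norm v \<le> 2 * norm y \<and> norm (y - q v) \<le> 1 / 2 * norm y" for y
    proof (cases "y = 0")
      case True
      thus ?thesis by (intro exI[of _ 0]) (simp add: linear_simps(3)[OF lin])
    next
      case False
      \<comment> \<open>Rescaling \<open>y\<close> to norm \<open>1/2\<close> puts it inside the open ball, where the \<open>x n\<close> are dense;
          undoing this doubles the precision \<open>1/4\<close> to \<open>1/2\<close>, relative to \<open>norm y\<close>.\<close>
      define a where "a = 2 * norm y"
      have a: "a > 0" using False by (simp add: a_def)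
      have "norm (y /\<^sub>R a) < 1" using a by (simp add: a_def)
      then obtain n where n: "dist (x n) (y /\<^sub>R a) < 1 / 4"
        using dense[of "y /\<^sub>R a" "1 / 4"] by auto
      define v :: "(nat \<times> nat, 'k) ell1" where "v = a *\<^sub>R ell1_unit (0, n)"
      have "y - q v = a *\<^sub>R (y /\<^sub>R a - x n)"
        using a q_unit[of 0 n]
        by (simp add: v_def linear_simps(5)[OF lin] scaleR_diff_right)
      hence "norm (y - q v) = a * dist (x n) (y /\<^sub>R a)"
        using a by (simp add: dist_norm norm_minus_commute)
      also have "\<dots> \<le> a * (1 / 4)"
        using a n by (intro mult_left_mono) auto
      finally have "norm (y - q v) \<le> 1 / 2 * norm y" by (simp add: a_def)
      moreover have "norm v \<le> 2 * norm y" by (simp add: v_def a_def)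
      ultimately show ?thesis by blast
    qed
  qed
  ultimately show ?thesis using q by blast
qed

end
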